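(* Let $\Gamma\subset PSL_2(\mathbb{R})$ be a Fuchsian group without elliptic elements such that the hyperbolic surface $\Sigma=\Gamma\backslash\mathbb{H}$ is geometrically infinite. Let $u_0\in\Omega_h$ be such that the horocyclic orbit $h_{\mathbb{R}}(u_0)$ is irregular (neither closed, nor dense in $\Omega_h$) and has asymptotic thinness $\mathrm{Inj}(u_0(\mathbb{R}_+))=+\infty$. Then at least one of the following holds: - the orbit $h_{\mathbb{R}}(u_0)$ is recurrent; - the closure $\overline{h_{\mathbb{R}}(u_0)}$ is not $h_{\mathbb{R}}$-minimal.
   Context: $\mathbb{H}$ is the Poincaré upper half-plane with its hyperbolic metric, and $T^1\Sigma$ is the unit tangent bundle of $\Sigma=\Gamma\backslash\mathbb{H}$. The surface is geometrically infinite if it is not geometrically finite (equivalently, $\Gamma$ is not finitely generated). For $u\in T^1\Sigma$, $\widetilde u$ denotes a lift to $T^1\mathbb{H}$, $u^+=\widetilde u(\infty)\in\partial\mathbb{H}$ is the positive endpoint of the geodesic of $\mathbb{H}$ defined by $\widetilde u$, and $u(\mathbb{R}_+)=(u(t))_{t\ge 0}$ is the unit-speed geodesic ray in $\Sigma$ defined by $u$. $h_{\mathbb{R}}=(h_s)_{s\in\mathbb{R}}$ is the horocyclic flow on $T^1\Sigma$: it is induced by the flow on $T^1\mathbb{H}$ that moves a unit vector $\widetilde u$ at unit speed along the horocycle centred at $\widetilde u(\infty)$ passing through the base point of $\widetilde u$, keeping the endpoint $\widetilde u(\infty)$ fixed. $h_{\mathbb{R}}(u)$ denotes the orbit of $u$.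 $\Omega_h\subset T^1\Sigma$ is the non-wandering set of $h_{\mathbb{R}}$; it is the set of $u$ with $u^+\in\Lambda$, where $\Lambda=\overline{\Gamma . i}\setminus\Gamma . i$ is the limit set of $\Gamma$ (closure taken in $\mathbb{H}\cup\partial\mathbb{H}$). The asymptotic thinness $\mathrm{Inj}(u(\mathbb{R}_+))\in[0,+\infty]$ is $\liminf_{t\to+\infty}$ of the injectivity radius of $\Sigma$ at the point $u(t)$. The orbit $h_{\mathbb{R}}(u)$ is recurrent if there is a sequence of reals $(s_n)$ with $|s_n|\to+\infty$ and $h_{s_n}(u)\to u$. A subset of $T^1\Sigma$ is $h_{\mathbb{R}}$-minimal if it is non-empty, closed, $h_{\mathbb{R}}$-invariant, and contains no proper non-empty closed $h_{\mathbb{R}}$-invariant subset. *)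

theory Defs
  imports "HOL-Analysis.Analysis" "HOL-Algebra.Coset"
begin

section \<open>Quotient topology\<close>

definition quotient_topology :: "'a topology \<Rightarrow> ('a \<Rightarrow> 'b) \<Rightarrow> 'b topology" where
  "quotient_topology X f =
     topology (\<lambda>U. U \<subseteq> f ` topspace X \<and> openin X {x \<in> topspace X. f x \<in> U})"

lemma openin_quotient_topology:
  "openin (quotient_topology X f) U \<longleftrightarrow>
     U \<subseteq> f ` topspace X \<and> openin X {x \<in> topspace X. f x \<in> U}"
proof -
  have "istopology (\<lambda>U. U \<subseteq> f ` topspace X \<and> openin X {x \<in> topspace X. f x \<in> U})"
    unfolding istopology_def
  proof (rule conjI; intro allI impI)
    fix S T
    assume S: "S \<subseteq> f ` topspace X \<and> openin X {x \<in> topspace X. f x \<in> S}"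
      and T: "T \<subseteq> f ` topspace X \<and> openin X {x \<in> topspace X. f x \<in> T}"
    have "{x \<in> topspace X. f x \<in> S \<inter> T} =
          {x \<in> topspace X. f x \<in> S} \<inter> {x \<in> topspace X. f x \<in> T}" by auto
    with S T show "S \<inter> T \<subseteq> f ` topspace X \<and> openin X {x \<in> topspace X. f x \<in> S \<inter> T}"
      by auto
  next
    fix K
    assume K: "\<forall>S\<in>K. S \<subseteq> f ` topspace X \<and> openin X {x \<in> topspace X. f x \<in> S}"
    have "{x \<in> topspace X. f x \<in> \<Union>K} = (\<Union>S\<in>K. {x \<in> topspace X. f x \<in> S})" by auto
    with K show "\<Union>K \<subseteq> f ` topspace X \<and> openin X {x \<in> topspace X. f x \<in> \<Union>K}"
      by (auto intro!: openin_Union)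
  qed
  then show ?thesis
    unfolding quotient_topology_def by simp
qed

lemma topspace_quotient_topology: "topspace (quotient_topology X f) = f ` topspace X"
proof
  show "topspace (quotient_topology X f) \<subseteq> f ` topspace X"
    using openin_topspace[of "quotient_topology X f"] openin_quotient_topology by metis
  have "{x \<in> topspace X. f x \<in> f ` topspace X} = topspace X" by auto
  then show "f ` topspace X \<subseteq> topspace (quotient_topology X f)"
    by (intro openin_subset) (simp add: openin_quotient_topology)
qed

lemma quotient_map_quotient_topology: "quotient_map X (quotient_topology X f) f"
  by (auto simp: quotient_map_def topspace_quotient_topology openin_quotient_topology)


section \<open>The hyperbolic plane and its unit tangent bundle\<close>

definition upper_half_plane :: "complex set" where
  "upper_half_plane = {z. Im z > 0}"

text \<open>Distance of the metric \<open>|dz| / Im z\<close>.\<close>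

definition hdist :: "complex \<Rightarrow> complex \<Rightarrow> real" where
  "hdist z w = arcosh (1 + (cmod (z - w))\<^sup>2 / (2 * Im z * Im w))"

definition hball :: "complex \<Rightarrow> real \<Rightarrow> complex set" where
  "hball z r = {w \<in> upper_half_plane. hdist z w < r}"

text \<open>A tangent vector is a pair \<open>(z, v)\<close> of a base point and a vector; its hyperbolic norm
  is \<open>|v| / Im z\<close>.\<close>

definition unit_tangent_H :: "(complex \<times> complex) set" where
  "unit_tangent_H = {(z, v). z \<in> upper_half_plane \<and> cmod v / Im z = 1}"


section \<open>The group $PSL_2(R)$ and its actions\<close>

definition SL2R :: "(real^2^2) monoid" where
  "SL2R = \<lparr>carrier = {A. det A = 1}, mult = (**), one = mat 1\<rparr>"

definition PSL2R :: "(real^2^2) set monoid" where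
  "PSL2R = SL2R Mod {mat 1, - mat 1}"

definition PSL2R_topology :: "(real^2^2) set topology" where
  "PSL2R_topology =
     quotient_topology (top_of_set (carrier SL2R)) (\<lambda>A. {mat 1, - mat 1} #>\<^bsub>SL2R\<^esub> A)"

definition mobius :: "real^2^2 \<Rightarrow> complex \<Rightarrow> complex" where
  "mobius A z =
     (of_real (A$1$1) * z + of_real (A$1$2)) / (of_real (A$2$1) * z + of_real (A$2$2))"

text \<open>The action on tangent vectors by the differential; the derivative of
  \<open>mobius A\<close> at \<open>z\<close> is \<open>1 / (cz + d)\<^sup>2\<close> when \<open>det A = 1\<close>.\<close>

definition mobius_T :: "real^2^2 \<Rightarrow> complex \<times> complex \<Rightarrow> complex \<times> complex" where
  "mobius_T A w =
     (mobius A (fst w), snd w / (of_real (A$2$1) * fst w + of_real (A$2$2))\<^sup>2)"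

definition pmobius :: "(real^2^2) set \<Rightarrow> complex \<Rightarrow> complex" where
  "pmobius M z = the_elem ((\<lambda>A. mobius A z) ` M)"

definition pmobius_T :: "(real^2^2) set \<Rightarrow> complex \<times> complex \<Rightarrow> complex \<times> complex" where
  "pmobius_T M w = the_elem ((\<lambda>A. mobius_T A w) ` M)"

lemma PSL2R_class: "{mat 1, - mat 1} #>\<^bsub>SL2R\<^esub> A = {A, - A}"
proof -
  have "(- mat 1) ** A = - A"
    by (simp add: vec_eq_iff matrix_matrix_mult_def forall_2 sum_2 mat_def)
  then show ?thesis
    by (auto simp: r_coset_def SL2R_def)
qed

lemma pmobius_class: "pmobius {A, - A} z = mobius A z"
proof -
  have "mobius (- A) z = mobius A z"
    using minus_divide_divide[of "of_real (A$1$1) * z + of_real (A$1$2)"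
        "of_real (A$2$1) * z + of_real (A$2$2)"]
    by (simp add: mobius_def)
  then show ?thesis by (simp add: pmobius_def)
qed

lemma pmobius_T_class: "pmobius_T {A, - A} w = mobius_T A w"
proof -
  have "(- of_real (A$2$1) * fst w - of_real (A$2$2))\<^sup>2 =
        (of_real (A$2$1) * fst w + of_real (A$2$2) :: complex)\<^sup>2"
    by (simp add: power2_eq_square algebra_simps)
  moreover have "mobius (- A) z = mobius A z" for z
    using pmobius_class[of "- A" z] pmobius_class[of A z] by (simp add: insert_commute)
  ultimately have "mobius_T (- A) w = mobius_T A w"
    by (simp add: mobius_T_def)
  then show ?thesis by (simp add: pmobius_T_def)
qed


section \<open>Geodesic and horocyclic flows on the unit tangent bundle of the hyperbolic plane\<close>

text \<open>The upward unit vector \<open>(\<i>, \<i>)\<close> at \<open>\<i>\<close> is used as base frame.  Its unit-speed geodesic is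
  \<open>t \<mapsto> exp t * \<i>\<close>, with positive endpoint \<open>\<infinity>\<close>, and the horocycle centred at \<open>\<infinity>\<close> through \<open>\<i>\<close>
  is \<open>Im z = 1\<close>, with unit-speed parametrization \<open>s \<mapsto> \<i> + s\<close>.  Both flows commute with
  orientation preserving isometries, which act simply transitively on unit vectors, so they
  are determined by transporting these two curves.\<close>

definition frame_transport :: "complex \<times> complex \<Rightarrow> complex \<times> complex \<Rightarrow> complex \<times> complex" where
  "frame_transport e w =
     (THE w'. \<exists>A \<in> carrier SL2R. w = mobius_T A (\<i>, \<i>) \<and> w' = mobius_T A e)"

definition geodesic_flow_H :: "real \<Rightarrow> complex \<times> complex \<Rightarrow> complex \<times> complex" where
  "geodesic_flow_H t = frame_transport (of_real (exp t) * \<i>, of_real (exp t) * \<i>)"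

definition horocyclic_flow_H :: "real \<Rightarrow> complex \<times> complex \<Rightarrow> complex \<times> complex" where
  "horocyclic_flow_H s = frame_transport (\<i> + of_real s, \<i>)"

lemma unit_tangent_H_frame:
  assumes "w \<in> unit_tangent_H"
  obtains A where "A \<in> carrier SL2R" "w = mobius_T A (\<i>, \<i>)"
proof -
  obtain z v where w: "w = (z, v)" by (cases w)
  have pos: "Im z > 0" and v: "cmod v = Im z"
    using assms by (auto simp: w unit_tangent_H_def upper_half_plane_def)
  then have v0: "v \<noteq> 0" by auto
  define q where "q = csqrt (\<i> / v)"
  have q2: "q\<^sup>2 = \<i> / v" by (simp add: q_def)
  with v0 have q0: "q \<noteq> 0" by auto
  define p where "p = z * q"
  define A :: "real^2^2" where "A = vector [vector [Im p, Re p], vector [Im q, Re q]]"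
  have A: "A$1$1 = Im p" "A$1$2 = Re p" "A$2$1 = Im q" "A$2$2 = Re q"
    by (simp_all add: A_def)
  have pq: "of_real (Im p) * \<i> + of_real (Re p) = p" "of_real (Im q) * \<i> + of_real (Re q) = q"
    by (simp_all add: complex_eq_iff)
  have "det A = Im z * (cmod q)\<^sup>2"
    unfolding cmod_power2 by (simp add: det_2 A p_def algebra_simps power2_eq_square)
  also have "(cmod q)\<^sup>2 = 1 / Im z"
    using q2 v by (simp add: norm_divide flip: norm_power)
  finally have "det A = 1" using pos by simp
  moreover have "w = mobius_T A (\<i>, \<i>)"
    using q0 v0 by (simp add: w mobius_T_def mobius_def A pq q2) (simp add: p_def)
  ultimately show thesis
    using that[of A] by (simp add: SL2R_def)
qed

lemma mobius_T_frame_inj: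
  assumes "A \<in> carrier SL2R" "B \<in> carrier SL2R" "mobius_T A (\<i>, \<i>) = mobius_T B (\<i>, \<i>)"
  shows "B = A \<or> B = - A"
proof -
  define p q where "p C = of_real (C$1$1) * \<i> + complex_of_real (C$1$2)"
    and "q C = of_real (C$2$1) * \<i> + complex_of_real (C$2$2)" for C :: "real^2^2"
  have q0: "q C \<noteq> 0" if "C \<in> carrier SL2R" for C
    using that by (auto simp: q_def SL2R_def det_2 complex_eq_iff)
  have eqs: "p A / q A = p B / q B" "\<i> / (q A)\<^sup>2 = \<i> / (q B)\<^sup>2"
    using assms(3) by (simp_all add: mobius_T_def mobius_def p_def q_def)
  from eqs(2) q0 assms have "(q A)\<^sup>2 = (q B)\<^sup>2" by (simp add: field_simps)
  then consider "q B = q A" | "q B = - q A" by (metis power2_eq_iff)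
  then show ?thesis
  proof cases
    case 1
    with eqs(1) q0 assms have "p B = p A" by simp
    with 1 show ?thesis by (auto simp: p_def q_def complex_eq_iff vec_eq_iff forall_2)
  next
    case 2
    with eqs(1) q0 assms have "p B = - p A" by (simp add: field_simps)
    with 2 show ?thesis by (auto simp: p_def q_def complex_eq_iff vec_eq_iff forall_2)
  qed
qed

lemma frame_transport_mobius_T:
  assumes "A \<in> carrier SL2R"
  shows "frame_transport e (mobius_T A (\<i>, \<i>)) = mobius_T A e"
  unfolding frame_transport_def
proof (rule the_equality)
  show "\<exists>B\<in>carrier SL2R. mobius_T A (\<i>, \<i>) = mobius_T B (\<i>, \<i>) \<and> mobius_T A e = mobius_T B e"
    using assms by blast
next
  fix w'
  assume "\<exists>B\<in>carrier SL2R. mobius_T A (\<i>, \<i>) = mobius_T B (\<i>, \<i>) \<and> w' = mobius_T B e"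
  then obtain B where B: "B \<in> carrier SL2R" "mobius_T A (\<i>, \<i>) = mobius_T B (\<i>, \<i>)"
    and w': "w' = mobius_T B e" by blast
  from mobius_T_frame_inj[OF assms B] have "{A, - A} = {B, - B}" by auto
  then show "w' = mobius_T A e"
    using pmobius_T_class w' by metis
qed


section \<open>Fuchsian groups\<close>

definition fuchsian :: "(real^2^2) set set \<Rightarrow> bool" where
  "fuchsian \<Gamma> \<longleftrightarrow>
     subgroup \<Gamma> PSL2R \<and> subtopology PSL2R_topology \<Gamma> = discrete_topology \<Gamma>"

definition elliptic :: "(real^2^2) set \<Rightarrow> bool" where
  "elliptic M \<longleftrightarrow>
     M \<in> carrier PSL2R \<and> M \<noteq> \<one>\<^bsub>PSL2R\<^esub> \<and> (\<exists>z \<in> upper_half_plane. pmobius M z = z)"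

definition dirichlet_domain :: "(real^2^2) set set \<Rightarrow> complex \<Rightarrow> complex set" where
  "dirichlet_domain \<Gamma> p =
     {w \<in> upper_half_plane. \<forall>M \<in> \<Gamma>. hdist w p \<le> hdist w (pmobius M p)}"

text \<open>A side is a nondegenerate intersection of the Dirichlet domain with the perpendicular
  bisector of its centre and another point of the orbit of the centre.\<close>

definition dirichlet_sides :: "(real^2^2) set set \<Rightarrow> complex \<Rightarrow> complex set set" where
  "dirichlet_sides \<Gamma> p =
     {S. \<exists>M \<in> \<Gamma>. pmobius M p \<noteq> p \<and>
           S = {w \<in> dirichlet_domain \<Gamma> p. hdist w p = hdist w (pmobius M p)} \<and>
           (\<exists>x \<in> S. \<exists>y \<in> S. x \<noteq> y)}"

definition geometrically_finite :: "(real^2^2) set set \<Rightarrow> bool" where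
  "geometrically_finite \<Gamma> \<longleftrightarrow>
     (\<exists>p \<in> upper_half_plane.
        (\<forall>M \<in> \<Gamma>. M \<noteq> \<one>\<^bsub>PSL2R\<^esub> \<longrightarrow> pmobius M p \<noteq> p) \<and> finite (dirichlet_sides \<Gamma> p))"


section \<open>The quotient surface and its unit tangent bundle\<close>

text \<open>Points of \<open>\<Sigma> = \<Gamma>\H\<close> and of its unit tangent bundle are \<open>\<Gamma>\<close>-orbits.  (When \<open>\<Gamma>\<close> has no elliptic
  elements, it acts freely, so the unit tangent bundle of the quotient is the
  quotient of the unit tangent bundle.)\<close>

definition proj :: "(real^2^2) set set \<Rightarrow> complex \<Rightarrow> complex set" where
  "proj \<Gamma> z = (\<lambda>M. pmobius M z) ` \<Gamma>"

definition proj_T :: "(real^2^2) set set \<Rightarrow> complex \<times> complex \<Rightarrow> (complex \<times> complex) set" where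
  "proj_T \<Gamma> w = (\<lambda>M. pmobius_T M w) ` \<Gamma>"

definition T1 :: "(real^2^2) set set \<Rightarrow> (complex \<times> complex) set topology" where
  "T1 \<Gamma> = quotient_topology (top_of_set unit_tangent_H) (proj_T \<Gamma>)"

text \<open>The flows commute with \<open>\<Gamma>\<close>, so the image of a \<open>\<Gamma>\<close>-orbit under a flow map is the \<open>\<Gamma>\<close>-orbit
  through the image of any lift.\<close>

definition horocyclic_flow :: "real \<Rightarrow> (complex \<times> complex) set \<Rightarrow> (complex \<times> complex) set" where
  "horocyclic_flow s u = horocyclic_flow_H s ` u"

definition geodesic_ray :: "(complex \<times> complex) set \<Rightarrow> real \<Rightarrow> complex set" where
  "geodesic_ray u t = (\<lambda>w. fst (geodesic_flow_H t w)) ` u"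

text \<open>The supremum of the radii of embedded balls centred at the point \<open>x\<close> of the surface.\<close>

definition injectivity_radius :: "(real^2^2) set set \<Rightarrow> complex set \<Rightarrow> ereal" where
  "injectivity_radius \<Gamma> x = Sup {ereal r | r. 0 \<le> r \<and> (\<forall>z \<in> x. inj_on (proj \<Gamma>) (hball z r))}"

definition asymptotic_thinness ::
    "(real^2^2) set set \<Rightarrow> (complex \<times> complex) set \<Rightarrow> ereal" where
  "asymptotic_thinness \<Gamma> u = Liminf at_top (\<lambda>t. injectivity_radius \<Gamma> (geodesic_ray u t))"


section \<open>Dynamics of the horocyclic flow\<close>

definition horocyclic_orbit :: "(complex \<times> complex) set \<Rightarrow> (complex \<times> complex) set set" where
  "horocyclic_orbit u = range (\<lambda>s. horocyclic_flow s u)"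

definition nonwandering_set :: "(real^2^2) set set \<Rightarrow> (complex \<times> complex) set set" where
  "nonwandering_set \<Gamma> =
     {u \<in> topspace (T1 \<Gamma>). \<forall>U. openin (T1 \<Gamma>) U \<and> u \<in> U \<longrightarrow>
        (\<forall>T. \<exists>s. \<bar>s\<bar> \<ge> T \<and> horocyclic_flow s ` U \<inter> U \<noteq> {})}"

definition irregular_orbit :: "(real^2^2) set set \<Rightarrow> (complex \<times> complex) set \<Rightarrow> bool" where
  "irregular_orbit \<Gamma> u \<longleftrightarrow>
     \<not> closedin (T1 \<Gamma>) (horocyclic_orbit u) \<and>
     \<not> nonwandering_set \<Gamma> \<subseteq> T1 \<Gamma> closure_of (horocyclic_orbit u)"

definition recurrent_orbit :: "(real^2^2) set set \<Rightarrow> (complex \<times> complex) set \<Rightarrow> bool" where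
  "recurrent_orbit \<Gamma> u \<longleftrightarrow>
     (\<exists>s :: nat \<Rightarrow> real. filterlim (\<lambda>n. \<bar>s n\<bar>) at_top sequentially \<and>
        limitin (T1 \<Gamma>) (\<lambda>n. horocyclic_flow (s n) u) u sequentially)"

definition horocyclic_invariant :: "(complex \<times> complex) set set \<Rightarrow> bool" where
  "horocyclic_invariant F \<longleftrightarrow> (\<forall>s. horocyclic_flow s ` F \<subseteq> F)"

definition horocyclic_minimal ::
    "(real^2^2) set set \<Rightarrow> (complex \<times> complex) set set \<Rightarrow> bool" where
  "horocyclic_minimal \<Gamma> F \<longleftrightarrow>
     F \<noteq> {} \<and> closedin (T1 \<Gamma>) F \<and> horocyclic_invariant F \<and>
     \<not> (\<exists>F'. F' \<subset> F \<and> F' \<noteq> {} \<and> closedin (T1 \<Gamma>) F' \<and> horocyclic_invariant F')"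

end

theory Submission
  imports Defs
begin

text \<open>
  The theorem rests on the fact that a non-recurrent orbit is locally closed.  Suppose that
  \<open>u\<^sub>0\<close> is not recurrent.  Some neighbourhood of \<open>u\<^sub>0\<close> is then visited by the orbit at bounded
  times only.  The arc described during a bounded interval of times is compact, hence closed, so
  near \<open>u\<^sub>0\<close> the closure of the orbit adds nothing to the orbit itself.  Translating along
  the flow, the same holds near every point of the orbit: the orbit is open in its closure, and
  \<open>closure - orbit\<close> is closed (\<open>closed_orbit_boundary\<close>).  This difference is invariant, it misses
  \<open>u\<^sub>0\<close>, and it is nonempty because an irregular orbit is not closed.  It is thus a closed invariant
  set which prevents the closure of the orbit from being minimal.

  The argument needs sequences instead of neighbourhoods, and closed arcs, in the quotient
  \<open>T1 \<Gamma>\<close>.  Both come from a description by matrices.  The group \<open>SL\<^sub>2\<close> acts transitively on unit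
  tangent vectors with stabilizers \<open>{1, -1}\<close>, so \<open>T1 \<Gamma>\<close> is the quotient of \<open>SL\<^sub>2\<close> by left
  multiplication with the preimage of \<open>\<Gamma>\<close>, also as a topological space
  (\<open>T1_point_eq_iff\<close>, \<open>quotient_map_T1_point\<close>), and the horocyclic flow becomes right
  multiplication by unipotent matrices (\<open>horocyclic_flow_T1_point\<close>).  Discreteness enters only through
  closedness of the preimage of \<open>\<Gamma>\<close> in the space of matrices (\<open>closed_lift\<close>): a closed subgroup
  times a compact arc of matrices is closed (\<open>closed_orbit_arc\<close>).
\<close>


section \<open>Matrices of determinant one\<close>

abbreviation SL2 :: "(real^2^2) set" where
  "SL2 \<equiv> carrier SL2R"

text \<open>The inverse of a matrix of determinant one, but a polynomial in the entries and therefore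
  continuous everywhere.\<close>

definition adjugate :: "real^2^2 \<Rightarrow> real^2^2" where
  "adjugate A = vector [vector [A$2$2, - (A$1$2)], vector [- (A$2$1), A$1$1]]"

definition unipotent :: "real \<Rightarrow> real^2^2" where
  "unipotent s = vector [vector [1, s], vector [0, 1]]"

lemma SL2_iff: "A \<in> SL2 \<longleftrightarrow> det A = 1"
  by (simp add: SL2R_def)

lemma adjugate_mult:
  assumes "A \<in> SL2"
  shows "adjugate A ** A = mat 1" "A ** adjugate A = mat 1"
  using assms
  by (simp_all add: SL2_iff det_2 adjugate_def vec_eq_iff forall_2 matrix_matrix_mult_def sum_2
      mat_def algebra_simps)

lemma SL2_mat_1: "mat 1 \<in> SL2"
  by (simp add: SL2_iff)

lemma SL2_mult: "A \<in> SL2 \<Longrightarrow> B \<in> SL2 \<Longrightarrow> A ** B \<in> SL2"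
  by (simp add: SL2_iff det_mul)

lemma SL2_minus: "A \<in> SL2 \<Longrightarrow> - A \<in> SL2"
  by (simp add: SL2_iff det_2)

lemma SL2_adjugate: "A \<in> SL2 \<Longrightarrow> adjugate A \<in> SL2"
  by (simp add: SL2_iff det_2 adjugate_def algebra_simps)

lemma SL2_unipotent: "unipotent s \<in> SL2"
  by (simp add: SL2_iff det_2 unipotent_def)

lemma unipotent_add: "unipotent s ** unipotent t = unipotent (s + t)"
  by (simp add: unipotent_def vec_eq_iff forall_2 matrix_matrix_mult_def sum_2)

lemma unipotent_0: "unipotent 0 = mat 1"
  by (simp add: unipotent_def vec_eq_iff forall_2 mat_def)

lemma minus_matrix_mult:
  fixes A B :: "real^2^2"
  shows "(- A) ** B = - (A ** B)" "A ** (- B) = - (A ** B)"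
  by (simp_all add: vec_eq_iff forall_2 matrix_matrix_mult_def sum_2)

lemma closed_SL2: "closed SL2"
proof -
  have "SL2 = (det :: real^2^2 \<Rightarrow> real) -` {1}"
    by (auto simp: SL2_iff)
  then show ?thesis
    by (simp add: det_2 continuous_closed_vimage continuous_intros)
qed

lemma continuous_matrix_mult [continuous_intros]:
  fixes f g :: "'a::t2_space \<Rightarrow> real^2^2"
  assumes "continuous F f" "continuous F g"
  shows "continuous F (\<lambda>x. f x ** g x)"
  using assms unfolding continuous_def matrix_matrix_mult_def
  by (intro tendsto_intros)

lemma tendsto_matrix_2 [tendsto_intros]:
  fixes a b c d :: "'a \<Rightarrow> real"
  assumes "(a \<longlongrightarrow> a') F" "(b \<longlongrightarrow> b') F" "(c \<longlongrightarrow> c') F" "(d \<longlongrightarrow> d') F"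
  shows "((\<lambda>x. vector [vector [a x, b x], vector [c x, d x]] :: real^2^2) \<longlongrightarrow>
    vector [vector [a', b'], vector [c', d']]) F"
proof -
  have "((\<lambda>x. (vector [vector [a x, b x], vector [c x, d x]] :: real^2^2) $ i $ j) \<longlongrightarrow>
      (vector [vector [a', b'], vector [c', d']] :: real^2^2) $ i $ j) F" for i j
    using assms exhaust_2[of i] exhaust_2[of j] by auto
  then show ?thesis by (intro vec_tendstoI)
qed

lemma continuous_adjugate [continuous_intros]:
  fixes f :: "'a::t2_space \<Rightarrow> real^2^2"
  assumes "continuous F f"
  shows "continuous F (\<lambda>x. adjugate (f x))"
  using assms unfolding continuous_def
  by (auto simp: adjugate_def intro!: tendsto_intros)

lemma continuous_unipotent [continuous_intros]:
  assumes "continuous F f"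
  shows "continuous F (\<lambda>x. unipotent (f x))"
  using assms unfolding continuous_def
  by (auto simp: unipotent_def intro!: tendsto_intros)

lemma group_SL2R: "group SL2R"
proof (rule groupI)
  fix A assume "A \<in> SL2"
  then show "\<exists>B\<in>SL2. B \<otimes>\<^bsub>SL2R\<^esub> A = \<one>\<^bsub>SL2R\<^esub>"
    using SL2_adjugate adjugate_mult(1) by (auto simp: SL2R_def)
qed (auto simp: SL2R_def det_mul matrix_mul_assoc)

lemma normal_center: "{mat 1, - mat 1} \<lhd> SL2R"
proof -
  interpret group SL2R by (rule group_SL2R)
  have minus_1: "- mat 1 \<in> SL2"
    by (intro SL2_minus SL2_mat_1)
  have "subgroup {mat 1, - mat 1} SL2R"
  proof (rule subgroupI)
    fix a assume "a \<in> {mat 1, - mat 1 :: real^2^2}"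
    then have "inv\<^bsub>SL2R\<^esub> a = a"
      by (intro inv_equality) (use minus_1 in \<open>auto simp: SL2R_def minus_matrix_mult\<close>)
    then show "inv\<^bsub>SL2R\<^esub> a \<in> {mat 1, - mat 1}"
      using \<open>a \<in> _\<close> by simp
  qed (use minus_1 in \<open>auto simp: SL2R_def minus_matrix_mult\<close>)
  then show ?thesis
    by (rule normalI) (auto simp: r_coset_def l_coset_def SL2R_def minus_matrix_mult)
qed


section \<open>Lifting the group\<close>

definition lift :: "(real^2^2) set set \<Rightarrow> (real^2^2) set" where
  "lift \<Gamma> = {A \<in> SL2. {A, - A} \<in> \<Gamma>}"

lemma lift_SL2: "A \<in> lift \<Gamma> \<Longrightarrow> A \<in> SL2"
  by (simp add: lift_def)

lemma lift_minus: "A \<in> lift \<Gamma> \<Longrightarrow> - A \<in> lift \<Gamma>"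
  by (simp add: lift_def SL2_minus insert_commute)

lemma one_PSL2R: "\<one>\<^bsub>PSL2R\<^esub> = {mat 1, - mat 1}"
  by (simp add: PSL2R_def)

lemma carrier_PSL2R: "carrier PSL2R = (\<lambda>A. {A, - A}) ` SL2"
  unfolding PSL2R_def carrier_FactGroup PSL2R_class ..

lemma mult_PSL2R:
  assumes "A \<in> SL2" "B \<in> SL2"
  shows "{A, - A} \<otimes>\<^bsub>PSL2R\<^esub> {B, - B} = {A ** B, - (A ** B)}"
  using normal.rcos_sum[OF normal_center assms]
  unfolding PSL2R_def mult_FactGroup PSL2R_class by (simp add: SL2R_def)

lemma lift_one:
  assumes "subgroup \<Gamma> PSL2R"
  shows "mat 1 \<in> lift \<Gamma>"
  using subgroup.one_closed[OF assms] by (simp add: lift_def SL2_mat_1 one_PSL2R)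

lemma lift_mult:
  assumes "subgroup \<Gamma> PSL2R" "A \<in> lift \<Gamma>" "B \<in> lift \<Gamma>"
  shows "A ** B \<in> lift \<Gamma>"
  using subgroup.m_closed[OF assms(1), of "{A, - A}" "{B, - B}"] assms(2,3)
  by (simp add: lift_def SL2_mult mult_PSL2R)

lemma lift_adjugate:
  assumes "subgroup \<Gamma> PSL2R" "A \<in> lift \<Gamma>"
  shows "adjugate A \<in> lift \<Gamma>"
proof -
  have A: "A \<in> SL2" "{A, - A} \<in> \<Gamma>"
    using assms(2) by (auto simp: lift_def)
  have "group PSL2R"
    unfolding PSL2R_def by (rule normal.factorgroup_is_group[OF normal_center])
  then have "inv\<^bsub>PSL2R\<^esub> {A, - A} = {adjugate A, - adjugate A}"
    using A(1) SL2_adjugate[OF A(1)]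
    by (intro group.inv_equality) (auto simp: mult_PSL2R adjugate_mult one_PSL2R carrier_PSL2R)
  then show ?thesis
    using subgroup.m_inv_closed[OF assms(1) A(2)] A(1) by (simp add: lift_def SL2_adjugate)
qed

lemma lift_surj:
  assumes "subgroup \<Gamma> PSL2R" "M \<in> \<Gamma>"
  obtains A where "A \<in> lift \<Gamma>" "M = {A, - A}"
  using subgroup.subset[OF assms(1)] assms(2) by (force simp: lift_def carrier_PSL2R)

text \<open>Discreteness is assumed for classes \<open>{A, - A}\<close>, with respect to a quotient topology.  Pulled back
  to matrices, it says that near the identity the group contains nothing outside \<open>{1, -1}\<close>.\<close>

lemma lift_isolated_identity:
  assumes "fuchsian \<Gamma>"
  obtains e where "e > 0" "\<And>A. A \<in> lift \<Gamma> \<Longrightarrow> dist A (mat 1) < e \<Longrightarrow> A = mat 1 \<or> A = - mat 1"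
proof -
  let ?c = "\<lambda>A. {mat 1, - mat 1} #>\<^bsub>SL2R\<^esub> A"
  have one: "{mat 1, - mat 1} \<in> \<Gamma>"
    using assms lift_one by (auto simp: fuchsian_def lift_def)
  have "openin (subtopology PSL2R_topology \<Gamma>) {{mat 1, - mat 1}}"
    using assms one by (simp add: fuchsian_def)
  then obtain U where U: "openin PSL2R_topology U" "{{mat 1, - mat 1}} = U \<inter> \<Gamma>"
    by (auto simp: openin_subtopology)
  from U(1) have "openin (top_of_set SL2) {A \<in> SL2. {A, - A} \<in> U}"
    by (simp add: PSL2R_topology_def openin_quotient_topology PSL2R_class)
  moreover have "mat 1 \<in> {A \<in> SL2. {A, - A} \<in> U}"
    using U(2) SL2_mat_1 by auto
  ultimately obtain e where e: "e > 0"
      "\<And>A. A \<in> SL2 \<Longrightarrow> dist A (mat 1) < e \<Longrightarrow> {A, - A} \<in> U"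
    by (auto simp: openin_euclidean_subtopology_iff)
  show thesis
  proof (rule that[OF e(1)])
    fix A assume A: "A \<in> lift \<Gamma>" "dist A (mat 1) < e"
    then have "{A, - A} \<in> U \<inter> \<Gamma>"
      using e(2) by (simp add: lift_def)
    then have "{A, - A} = {mat 1, - mat 1}"
      by (simp flip: U(2))
    then show "A = mat 1 \<or> A = - mat 1"
      by (auto simp: doubleton_eq_iff)
  qed
qed

text \<open>A discrete subgroup is closed.  If \<open>C\<close> and \<open>C'\<close> in the subgroup are both close to a matrix \<open>B\<close>,
  then \<open>C\<close> inverse times \<open>C'\<close> is close to the identity, so \<open>C' = C\<close> or \<open>C' = - C\<close>.  A small ball around
  \<open>B\<close> therefore contains at most two elements of the subgroup, and \<open>B\<close> can only be a limit of
  the subgroup by being one of them.\<close>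

lemma closed_lift:
  assumes "fuchsian \<Gamma>"
  shows "closed (lift \<Gamma>)"
proof -
  have sub: "subgroup \<Gamma> PSL2R"
    using assms by (simp add: fuchsian_def)
  obtain e where e: "e > 0"
      "\<And>A. A \<in> lift \<Gamma> \<Longrightarrow> dist A (mat 1) < e \<Longrightarrow> A = mat 1 \<or> A = - mat 1"
    using lift_isolated_identity[OF assms] by blast
  have "B \<in> lift \<Gamma>" if B: "B \<in> closure (lift \<Gamma>)" for B
  proof -
    have BSL: "B \<in> SL2"
      using closure_minimal[of "lift \<Gamma>", OF _ closed_SL2] lift_SL2 B by blast
    have "continuous (at (B, B)) (\<lambda>p. adjugate (fst p) ** snd p)"
      by (intro continuous_intros)
    then obtain d where d: "d > 0" "\<And>p. dist p (B, B) < d \<Longrightarrow>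
        dist (adjugate (fst p) ** snd p) (mat 1) < e"
      using \<open>e > 0\<close> BSL unfolding continuous_at_eps_delta by (force simp: adjugate_mult)
    have near: "C' = C \<or> C' = - C"
      if "C \<in> lift \<Gamma>" "C' \<in> lift \<Gamma>" "C \<in> ball B (d/2)" "C' \<in> ball B (d/2)" for C C'
    proof -
      have "dist (C, C') (B, B) < d"
        using that(3,4) sqrt_sum_squares_le_sum_abs[of "dist C B" "dist C' B"]
        by (simp add: dist_Pair_Pair dist_commute)
      then have "adjugate C ** C' = mat 1 \<or> adjugate C ** C' = - mat 1"
        using d(2)[of "(C, C')"] e(2) lift_mult[OF sub lift_adjugate[OF sub]] that by simp
      then have "C ** (adjugate C ** C') = C \<or> C ** (adjugate C ** C') = - C"
        by (auto simp: minus_matrix_mult)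
      then show ?thesis
        using that lift_SL2 by (simp add: matrix_mul_assoc adjugate_mult)
    qed
    have "finite (ball B (d/2) \<inter> lift \<Gamma>)"
    proof (cases "ball B (d/2) \<inter> lift \<Gamma> = {}")
      case False
      then obtain C where "C \<in> ball B (d/2) \<inter> lift \<Gamma>" by blast
      with near[of C] have "ball B (d/2) \<inter> lift \<Gamma> \<subseteq> {C, - C}" by blast
      then show ?thesis by (rule finite_subset) simp
    qed simp
    then have "closure (ball B (d/2) \<inter> lift \<Gamma>) = ball B (d/2) \<inter> lift \<Gamma>"
      by (simp add: finite_imp_closed)
    then show ?thesis
      using open_Int_closure_subset[of "ball B (d/2)" "lift \<Gamma>"] B \<open>d > 0\<close> by auto
  qed
  then show ?thesis
    unfolding closure_subset_eq[symmetric] by (rule subsetI)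
qed


section \<open>Matrices as unit tangent vectors\<close>

definition frame :: "real^2^2 \<Rightarrow> complex \<times> complex" where
  "frame A = mobius_T A (\<i>, \<i>)"

lemma mobius_denom_nonzero:
  assumes "A \<in> SL2" "Im z > 0"
  shows "of_real (A$2$1) * z + of_real (A$2$2) \<noteq> (0 :: complex)"
proof
  assume "of_real (A$2$1) * z + of_real (A$2$2) = 0"
  with assms(2) have "A$2$1 = 0" "A$2$2 = 0"
    by (auto simp: complex_eq_iff)
  with assms(1) show False
    by (simp add: SL2_iff det_2)
qed

lemma mobius_T_mult:
  assumes "A \<in> SL2" "B \<in> SL2" "Im (fst w) > 0"
  shows "mobius_T (A ** B) w = mobius_T A (mobius_T B w)"
proof -
  define z p q where "z = fst w"
    and "p = of_real (B$1$1) * z + complex_of_real (B$1$2)"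
    and "q = of_real (B$2$1) * z + complex_of_real (B$2$2)"
  have q: "q \<noteq> 0"
    using mobius_denom_nonzero[OF assms(2,3)] by (simp add: q_def z_def)
  have comb: "of_real ((A ** B)$i$1) * z + of_real ((A ** B)$i$2) =
      (of_real (A$i$1) * (p / q) + of_real (A$i$2)) * q" for i
    using q by (simp add: matrix_matrix_mult_def sum_2 field_simps)
      (simp add: p_def q_def algebra_simps)
  show ?thesis
    using q unfolding mobius_T_def mobius_def fst_conv snd_conv
    by (simp add: comb power_mult_distrib flip: z_def p_def q_def)
qed

lemma frame_mult:
  assumes "A \<in> SL2" "B \<in> SL2"
  shows "frame (A ** B) = mobius_T A (frame B)"
  using mobius_T_mult[OF assms] by (simp add: frame_def)

lemma frame_inj: "A \<in> SL2 \<Longrightarrow> B \<in> SL2 \<Longrightarrow> frame A = frame B \<Longrightarrow> B = A \<or> B = - A"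
  unfolding frame_def by (rule mobius_T_frame_inj)

lemma horocyclic_flow_H_frame:
  assumes "A \<in> SL2"
  shows "horocyclic_flow_H s (frame A) = frame (A ** unipotent s)"
proof -
  have "frame (unipotent s) = (\<i> + of_real s, \<i>)"
    by (simp add: frame_def mobius_T_def mobius_def unipotent_def)
  then show ?thesis
    using frame_transport_mobius_T[OF assms]
    by (simp add: horocyclic_flow_H_def frame_mult[OF assms SL2_unipotent])
      (simp add: frame_def)
qed

lemma frame_in_unit_tangent:
  assumes "A \<in> SL2"
  shows "frame A \<in> unit_tangent_H"
proof -
  define p q where "p = of_real (A$1$1) * \<i> + complex_of_real (A$1$2)"
    and "q = of_real (A$2$1) * \<i> + complex_of_real (A$2$2)"
  have q: "q \<noteq> 0"
    using mobius_denom_nonzero[OF assms, of \<i>] by (simp add: q_def)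
  have "Im (p / q) = det A / (cmod q)\<^sup>2"
    unfolding Im_divide cmod_power2 by (simp add: p_def q_def det_2 algebra_simps)
  then have "Im (p / q) = 1 / (cmod q)\<^sup>2"
    using assms by (simp add: SL2_iff)
  moreover have "frame A = (p / q, \<i> / q\<^sup>2)"
    by (simp add: frame_def mobius_T_def mobius_def p_def q_def)
  ultimately show ?thesis
    using q by (simp add: unit_tangent_H_def upper_half_plane_def norm_divide norm_power)
qed

lemma frame_image: "frame ` SL2 = unit_tangent_H"
  using frame_in_unit_tangent unit_tangent_H_frame unfolding frame_def by blast

lemma continuous_on_frame: "continuous_on SL2 frame"
  unfolding frame_def mobius_T_def mobius_def
  by (intro continuous_intros) (auto dest: mobius_denom_nonzero[where z = \<i>])

text \<open>The section solves \<open>q\<^sup>2 = \<i> / v\<close> for the image \<open>q = c * \<i> + d\<close> of \<open>\<i>\<close> under the lower row; the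
  upper row is then determined by the base point.  Dividing by the value \<open>q\<^sub>0\<close> at \<open>A\<close> before taking
  the root moves the branch cut of \<open>csqrt\<close> away from the vector in question and
  selects \<open>A\<close> rather than \<open>- A\<close>.  Continuity may fail where the root meets the cut, but the value is
  a matrix with the prescribed frame on all of \<open>unit_tangent_H\<close>, since only \<open>q\<^sup>2\<close> matters.\<close>

lemma frame_local_section:
  assumes "A \<in> SL2"
  obtains \<sigma> where "\<sigma> (frame A) = A" "continuous (at (frame A)) \<sigma>"
    "\<And>w. w \<in> unit_tangent_H \<Longrightarrow> \<sigma> w \<in> SL2 \<and> frame (\<sigma> w) = w"
proof -
  define p\<^sub>0 q\<^sub>0 where "p\<^sub>0 = of_real (A$1$1) * \<i> + complex_of_real (A$1$2)"
    and "q\<^sub>0 = of_real (A$2$1) * \<i> + complex_of_real (A$2$2)"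
  define q where "q w = q\<^sub>0 * csqrt (\<i> / (snd w * q\<^sub>0\<^sup>2))" for w :: "complex \<times> complex"
  define \<sigma> :: "complex \<times> complex \<Rightarrow> real^2^2" where "\<sigma> w =
    vector [vector [Im (fst w * q w), Re (fst w * q w)], vector [Im (q w), Re (q w)]]" for w
  have q\<^sub>0: "q\<^sub>0 \<noteq> 0"
    using mobius_denom_nonzero[OF assms, of \<i>] by (simp add: q\<^sub>0_def)
  have fA: "frame A = (p\<^sub>0 / q\<^sub>0, \<i> / q\<^sub>0\<^sup>2)"
    by (simp add: frame_def mobius_T_def mobius_def p\<^sub>0_def q\<^sub>0_def)
  have one: "\<i> / (snd (frame A) * q\<^sub>0\<^sup>2) = 1"
    using q\<^sub>0 by (simp add: fA)
  have "q (frame A) = q\<^sub>0"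
    unfolding q_def one by simp
  then have 1: "\<sigma> (frame A) = A"
    using q\<^sub>0 by (simp add: \<sigma>_def fA vec_eq_iff forall_2) (simp add: p\<^sub>0_def q\<^sub>0_def)
  have "isCont csqrt (\<i> / (snd (frame A) * q\<^sub>0\<^sup>2))"
    unfolding one by (rule continuous_at_csqrt) simp
  moreover have "isCont (\<lambda>w. \<i> / (snd w * q\<^sub>0\<^sup>2)) (frame A)"
    using q\<^sub>0 by (intro continuous_intros) (simp add: fA)
  ultimately have "isCont (\<lambda>w. csqrt (\<i> / (snd w * q\<^sub>0\<^sup>2))) (frame A)"
    by (rule isCont_o2[rotated])
  then have "isCont q (frame A)"
    unfolding q_def by (intro continuous_intros)
  then have 2: "continuous (at (frame A)) \<sigma>"
    unfolding \<sigma>_def isCont_def by (intro tendsto_intros)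
  have 3: "\<sigma> w \<in> SL2 \<and> frame (\<sigma> w) = w" if "w \<in> unit_tangent_H" for w
  proof -
    have pos: "Im (fst w) > 0" and v: "cmod (snd w) = Im (fst w)"
      using that by (auto simp: unit_tangent_H_def upper_half_plane_def)
    then have v0: "snd w \<noteq> 0" by auto
    have q2: "(q w)\<^sup>2 = \<i> / snd w"
      using q\<^sub>0 by (simp add: q_def power_mult_distrib)
    then have "q w \<noteq> 0"
      using v0 by auto
    have "det (\<sigma> w) = Im (fst w) * (cmod (q w))\<^sup>2"
      unfolding cmod_power2 by (simp add: det_2 \<sigma>_def algebra_simps power2_eq_square)
    also have "(cmod (q w))\<^sup>2 = 1 / Im (fst w)"
      using q2 v by (simp add: norm_divide flip: norm_power)
    finally have "\<sigma> w \<in> SL2"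
      using pos by (simp add: SL2_iff)
    moreover have "complex_of_real (Im x) * \<i> + of_real (Re x) = x" for x
      by (simp add: complex_eq_iff)
    then have "frame (\<sigma> w) = w"
      using \<open>q w \<noteq> 0\<close> v0 unfolding frame_def mobius_T_def mobius_def
      by (simp add: \<sigma>_def q2 prod_eq_iff del: times_complex.sel)
    ultimately show ?thesis ..
  qed
  show thesis
    using that[OF 1 2 3] .
qed

text \<open>Continuous local sections through every matrix make the map open.\<close>

lemma quotient_map_frame: "quotient_map (top_of_set SL2) (top_of_set unit_tangent_H) frame"
proof (rule continuous_open_imp_quotient_map)
  show "continuous_map (top_of_set SL2) (top_of_set unit_tangent_H) frame"
    using continuous_on_frame frame_in_unit_tangent by auto
  show "open_map (top_of_set SL2) (top_of_set unit_tangent_H) frame"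
    unfolding open_map_def
  proof (intro allI impI)
    fix V assume V: "openin (top_of_set SL2) V"
    show "openin (top_of_set unit_tangent_H) (frame ` V)"
      unfolding openin_euclidean_subtopology_iff
    proof (intro conjI ballI)
      show "frame ` V \<subseteq> unit_tangent_H"
        using openin_imp_subset[OF V] frame_in_unit_tangent by blast
      fix w assume "w \<in> frame ` V"
      then obtain A where A: "A \<in> V" "w = frame A" by blast
      with V have ASL: "A \<in> SL2"
        using openin_imp_subset by blast
      obtain e where e: "e > 0" "\<And>B. B \<in> SL2 \<Longrightarrow> dist B A < e \<Longrightarrow> B \<in> V"
        using V A(1) by (auto simp: openin_euclidean_subtopology_iff)
      obtain \<sigma> where \<sigma>: "\<sigma> (frame A) = A" "continuous (at (frame A)) \<sigma>"
        "\<And>w. w \<in> unit_tangent_H \<Longrightarrow> \<sigma> w \<in> SL2 \<and> frame (\<sigma> w) = w"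
        using frame_local_section[OF ASL] by blast
      obtain d where "d > 0" "\<And>w'. dist w' w < d \<Longrightarrow> dist (\<sigma> w') A < e"
        using \<sigma>(1,2) e(1) unfolding continuous_at_eps_delta A(2) by metis
      then have "\<forall>w'\<in>unit_tangent_H. dist w' w < d \<longrightarrow> w' \<in> frame ` V"
        using \<sigma>(3) e(2) by (metis image_eqI)
      with \<open>d > 0\<close> show "\<exists>e>0. \<forall>w'\<in>unit_tangent_H. dist w' w < e \<longrightarrow> w' \<in> frame ` V"
        by blast
    qed
  qed
qed (simp add: frame_image)


section \<open>Matrices as points of the unit tangent bundle of the surface\<close>

definition T1_point :: "(real^2^2) set set \<Rightarrow> real^2^2 \<Rightarrow> (complex \<times> complex) set" where
  "T1_point \<Gamma> A = proj_T \<Gamma> (frame A)"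

lemma T1_point_eq:
  assumes "subgroup \<Gamma> PSL2R" "A \<in> SL2"
  shows "T1_point \<Gamma> A = (\<lambda>C. frame (C ** A)) ` lift \<Gamma>"
proof -
  have \<Gamma>: "\<Gamma> = (\<lambda>C. {C, - C}) ` lift \<Gamma>"
  proof (intro subset_antisym subsetI)
    fix M assume "M \<in> \<Gamma>"
    then obtain C where "C \<in> lift \<Gamma>" "M = {C, - C}"
      by (rule lift_surj[OF assms(1)])
    then show "M \<in> (\<lambda>C. {C, - C}) ` lift \<Gamma>"
      by simp
  qed (auto simp: lift_def)
  have "T1_point \<Gamma> A = (\<lambda>M. pmobius_T M (frame A)) ` (\<lambda>C. {C, - C}) ` lift \<Gamma>"
    unfolding T1_point_def proj_T_def by (subst \<Gamma>) (rule refl)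
  then show ?thesis
    unfolding image_image pmobius_T_class
    by (simp add: frame_mult[OF lift_SL2 assms(2)] cong: image_cong)
qed

lemma T1_point_eq_iff:
  assumes "subgroup \<Gamma> PSL2R" "A \<in> SL2" "B \<in> SL2"
  shows "T1_point \<Gamma> A = T1_point \<Gamma> B \<longleftrightarrow> (\<exists>C\<in>lift \<Gamma>. B = C ** A)"
proof
  assume "T1_point \<Gamma> A = T1_point \<Gamma> B"
  moreover have "frame B \<in> T1_point \<Gamma> B"
    unfolding T1_point_eq[OF assms(1,3)] using lift_one[OF assms(1)]
    by (intro image_eqI[of _ _ "mat 1"]) auto
  ultimately obtain C where C: "C \<in> lift \<Gamma>" "frame B = frame (C ** A)"
    unfolding T1_point_eq[OF assms(1,2)] by auto
  then have "B = C ** A \<or> B = (- C) ** A"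
    using frame_inj[of "C ** A" B] assms lift_SL2 SL2_mult by (simp add: minus_matrix_mult)
  then show "\<exists>C\<in>lift \<Gamma>. B = C ** A"
    using C(1) lift_minus by blast
next
  assume "\<exists>C\<in>lift \<Gamma>. B = C ** A"
  then obtain C where C: "C \<in> lift \<Gamma>" "B = C ** A" by blast
  have A: "A = adjugate C ** B"
    using C by (simp add: matrix_mul_assoc adjugate_mult lift_SL2)
  have "(\<lambda>D. frame (D ** A)) ` lift \<Gamma> \<subseteq> (\<lambda>D. frame (D ** B)) ` lift \<Gamma>"
  proof (rule image_subsetI)
    fix D assume "D \<in> lift \<Gamma>"
    then show "frame (D ** A) \<in> (\<lambda>D. frame (D ** B)) ` lift \<Gamma>"
      using lift_mult[OF assms(1) _ lift_adjugate[OF assms(1) C(1)]]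
      by (intro image_eqI[of _ _ "D ** adjugate C"]) (simp_all add: A matrix_mul_assoc)
  qed
  moreover have "(\<lambda>D. frame (D ** B)) ` lift \<Gamma> \<subseteq> (\<lambda>D. frame (D ** A)) ` lift \<Gamma>"
  proof (rule image_subsetI)
    fix D assume "D \<in> lift \<Gamma>"
    then show "frame (D ** B) \<in> (\<lambda>D. frame (D ** A)) ` lift \<Gamma>"
      using lift_mult[OF assms(1) _ C(1)]
      by (intro image_eqI[of _ _ "D ** C"]) (simp_all add: C(2) matrix_mul_assoc)
  qed
  ultimately show "T1_point \<Gamma> A = T1_point \<Gamma> B"
    unfolding T1_point_eq[OF assms(1,2)] T1_point_eq[OF assms(1,3)] by blast
qed

lemma horocyclic_flow_T1_point:
  assumes "subgroup \<Gamma> PSL2R" "A \<in> SL2"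
  shows "horocyclic_flow s (T1_point \<Gamma> A) = T1_point \<Gamma> (A ** unipotent s)"
  unfolding horocyclic_flow_def T1_point_eq[OF assms]
    T1_point_eq[OF assms(1) SL2_mult[OF assms(2) SL2_unipotent]] image_image
  using assms(2) by (intro image_cong)
    (simp_all add: horocyclic_flow_H_frame lift_SL2 SL2_mult matrix_mul_assoc)

lemma quotient_map_T1_point: "quotient_map (top_of_set SL2) (T1 \<Gamma>) (T1_point \<Gamma>)"
proof -
  have "quotient_map (top_of_set SL2) (T1 \<Gamma>) (proj_T \<Gamma> \<circ> frame)"
    unfolding T1_def
    by (rule quotient_map_compose[OF quotient_map_frame quotient_map_quotient_topology])
  then show ?thesis
    by (simp add: T1_point_def[abs_def] comp_def)
qed

lemma topspace_T1: "topspace (T1 \<Gamma>) = T1_point \<Gamma> ` SL2"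
  using quotient_map_T1_point[of \<Gamma>] by (simp add: quotient_map_def)

text \<open>Closed sets of the quotient become closed sets of matrices, in a metric space where closures can be
  handled by sequences.\<close>

lemma closedin_T1_iff:
  "closedin (T1 \<Gamma>) C \<longleftrightarrow> C \<subseteq> T1_point \<Gamma> ` SL2 \<and> closed {A \<in> SL2. T1_point \<Gamma> A \<in> C}"
proof -
  have "closedin (top_of_set SL2) {A \<in> SL2. T1_point \<Gamma> A \<in> C} \<longleftrightarrow>
      closed {A \<in> SL2. T1_point \<Gamma> A \<in> C}"
    using closedin_closed_eq[OF closed_SL2] by auto
  then show ?thesis
    using quotient_map_T1_point[of \<Gamma>] closedin_subset[of "T1 \<Gamma>" C]
    unfolding quotient_map_closedin topspace_T1[symmetric] by auto
qed


section \<open>Horocyclic orbits\<close>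

text \<open>The preimage in \<open>SL\<^sub>2\<close> of the part of the horocyclic orbit of \<open>T1_point \<Gamma> A\<close> that is described at
  the times in \<open>S\<close>.\<close>

definition orbit_arc :: "(real^2^2) set set \<Rightarrow> real^2^2 \<Rightarrow> real set \<Rightarrow> (real^2^2) set" where
  "orbit_arc \<Gamma> A S = {C ** (A ** unipotent s) | C s. C \<in> lift \<Gamma> \<and> s \<in> S}"

lemma T1_point_in_orbit_iff:
  assumes "subgroup \<Gamma> PSL2R" "A \<in> SL2" "B \<in> SL2"
  shows "T1_point \<Gamma> B \<in> horocyclic_orbit (T1_point \<Gamma> A) \<longleftrightarrow> B \<in> orbit_arc \<Gamma> A UNIV"
proof -
  have "T1_point \<Gamma> B \<in> horocyclic_orbit (T1_point \<Gamma> A) \<longleftrightarrow>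
      (\<exists>s. T1_point \<Gamma> (A ** unipotent s) = T1_point \<Gamma> B)"
    using assms(1,2) by (auto simp: horocyclic_orbit_def horocyclic_flow_T1_point)
  also have "\<dots> \<longleftrightarrow> (\<exists>s. \<exists>C\<in>lift \<Gamma>. B = C ** (A ** unipotent s))"
    by (simp add: T1_point_eq_iff assms SL2_mult SL2_unipotent)
  finally show ?thesis
    by (auto simp: orbit_arc_def)
qed

text \<open>A matrix \<open>B\<close> lies over the arc iff \<open>B\<close> times the inverse of \<open>A ** unipotent s\<close> lies in the
  closed subgroup \<open>lift \<Gamma>\<close> for some \<open>s\<close>.  This is a closed condition on \<open>(s, B)\<close>, and projecting along the
  compact set \<open>S\<close> preserves closedness.\<close>

lemma closed_orbit_arc:
  assumes "fuchsian \<Gamma>" "A \<in> SL2" "compact S"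
  shows "closed (orbit_arc \<Gamma> A S)"
proof -
  let ?f = "\<lambda>p. snd p ** adjugate (A ** unipotent (fst p))"
  have "closed (?f -` lift \<Gamma>)"
    by (intro continuous_closed_vimage closed_lift assms(1) continuous_intros)
  then have "closed {B. \<exists>s. s \<in> S \<and> (s, B) \<in> ?f -` lift \<Gamma>}"
    by (rule closed_compact_projection[OF assms(3)])
  moreover have "B ** adjugate (A ** unipotent s) \<in> lift \<Gamma> \<longleftrightarrow>
      (\<exists>C\<in>lift \<Gamma>. B = C ** (A ** unipotent s))" for B s
    using adjugate_mult[OF SL2_mult[OF assms(2) SL2_unipotent[of s]]]
    by (metis matrix_mul_assoc matrix_mul_rid)
  then have "{B. \<exists>s. s \<in> S \<and> (s, B) \<in> ?f -` lift \<Gamma>} = orbit_arc \<Gamma> A S"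
    by (auto simp: orbit_arc_def)
  ultimately show ?thesis by simp
qed

text \<open>Limits in the quotient lift to limits of matrices: the closure upstairs is invariant under
  \<open>lift \<Gamma>\<close>, so it is the full preimage of its image, and this image is a closed set containing the orbit.\<close>

lemma T1_point_in_orbit_closure:
  assumes "subgroup \<Gamma> PSL2R" "A \<in> SL2" "B \<in> SL2"
    and "T1_point \<Gamma> B \<in> T1 \<Gamma> closure_of horocyclic_orbit (T1_point \<Gamma> A)"
  shows "B \<in> closure (orbit_arc \<Gamma> A UNIV)"
proof -
  let ?Q = "orbit_arc \<Gamma> A UNIV"
  have QSL: "?Q \<subseteq> SL2"
    using assms(2) lift_SL2[of _ \<Gamma>] by (auto simp: orbit_arc_def SL2_mult SL2_unipotent)
  then have clSL: "closure ?Q \<subseteq> SL2"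
    by (rule closure_minimal[OF _ closed_SL2])
  have inv: "C ** D \<in> closure ?Q" if "C \<in> lift \<Gamma>" "D \<in> closure ?Q" for C D
  proof -
    have "(**) C ` closure ?Q \<subseteq> closure ((**) C ` ?Q)"
      by (intro image_closure_subset closed_closure closure_subset
          continuous_at_imp_continuous_on ballI continuous_intros)
    also have "(**) C ` ?Q \<subseteq> ?Q"
      using lift_mult[OF assms(1) that(1)] by (force simp: orbit_arc_def matrix_mul_assoc)
    then have "closure ((**) C ` ?Q) \<subseteq> closure ?Q"
      by (rule closure_mono)
    finally show ?thesis
      using that(2) by blast
  qed
  have pre: "{D \<in> SL2. T1_point \<Gamma> D \<in> T1_point \<Gamma> ` closure ?Q} = closure ?Q"
  proof (intro subset_antisym subsetI)
    fix D assume "D \<in> {D \<in> SL2. T1_point \<Gamma> D \<in> T1_point \<Gamma> ` closure ?Q}"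
    then obtain D' where "D \<in> SL2" "D' \<in> closure ?Q" "T1_point \<Gamma> D' = T1_point \<Gamma> D"
      by fastforce
    then show "D \<in> closure ?Q"
      using clSL inv T1_point_eq_iff[OF assms(1), of D' D] by blast
  qed (use clSL in auto)
  have "closedin (T1 \<Gamma>) (T1_point \<Gamma> ` closure ?Q)"
    unfolding closedin_T1_iff pre using clSL by auto
  moreover have "horocyclic_orbit (T1_point \<Gamma> A) \<subseteq> T1_point \<Gamma> ` closure ?Q"
  proof
    fix v assume v: "v \<in> horocyclic_orbit (T1_point \<Gamma> A)"
    then obtain s where "v = T1_point \<Gamma> (A ** unipotent s)"
      using assms by (auto simp: horocyclic_orbit_def horocyclic_flow_T1_point)
    moreover have "A ** unipotent s \<in> SL2"
      using assms(2) SL2_unipotent by (rule SL2_mult)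
    ultimately show "v \<in> T1_point \<Gamma> ` closure ?Q"
      using T1_point_in_orbit_iff[OF assms(1,2)] v closure_subset by blast
  qed
  ultimately have "T1_point \<Gamma> B \<in> T1_point \<Gamma> ` closure ?Q"
    using closure_of_minimal assms(4) by blast
  then show ?thesis
    using pre assms(3) by blast
qed

lemma limitin_T1_point:
  assumes "\<And>n. C n \<in> SL2" "A \<in> SL2" "C \<longlonglongrightarrow> A"
  shows "limitin (T1 \<Gamma>) (\<lambda>n. T1_point \<Gamma> (C n)) (T1_point \<Gamma> A) sequentially"
proof -
  have "limitin (top_of_set SL2) C A sequentially"
    using assms by (auto simp: limitin_subtopology)
  then have "limitin (T1 \<Gamma>) (T1_point \<Gamma> \<circ> C) (T1_point \<Gamma> A) sequentially"
    by (rule continuous_map_limit[OF quotient_imp_continuous_map[OF quotient_map_T1_point]])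
  then show ?thesis
    by (simp add: comp_def)
qed

text \<open>If the difference were not closed, a matrix \<open>B\<close> over the orbit would be a limit of matrices \<open>D\<close> over
  the closure but off the orbit.  Each \<open>D\<close> is a limit of matrices over the orbit, and, since the
  arc of times in \<open>{-n..n}\<close> is closed and misses \<open>D\<close>, of such matrices at times beyond \<open>n\<close>.
  Hence the orbit returns to the point of \<open>B\<close> at arbitrarily large times, and flowing from there back to
  the starting point shows that it is recurrent.\<close>

lemma closed_orbit_boundary:
  assumes "fuchsian \<Gamma>" "A \<in> SL2" "\<not> recurrent_orbit \<Gamma> (T1_point \<Gamma> A)"
  shows "closedin (T1 \<Gamma>)
    (T1 \<Gamma> closure_of horocyclic_orbit (T1_point \<Gamma> A) - horocyclic_orbit (T1_point \<Gamma> A))"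
    (is "closedin _ (?F - ?O)")
proof -
  have sub: "subgroup \<Gamma> PSL2R"
    using assms(1) by (simp add: fuchsian_def)
  let ?E = "{B \<in> SL2. T1_point \<Gamma> B \<in> ?F - ?O}"
  have "B \<in> ?E" if B: "B \<in> closure ?E" for B
  proof (rule ccontr)
    assume nB: "B \<notin> ?E"
    have "closure ?E \<subseteq> {B \<in> SL2. T1_point \<Gamma> B \<in> ?F}"
      using closedin_T1_iff[of \<Gamma> ?F] by (intro closure_minimal) auto
    then have BSL: "B \<in> SL2" and BF: "T1_point \<Gamma> B \<in> ?F"
      using B by auto
    with nB have "T1_point \<Gamma> B \<in> ?O" by simp
    then obtain G t where G: "G \<in> lift \<Gamma>" "B = G ** (A ** unipotent t)"
      using T1_point_in_orbit_iff[OF sub assms(2) BSL] by (auto simp: orbit_arc_def)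
    have "\<exists>C s. C \<in> lift \<Gamma> \<and> real n \<le> \<bar>s\<bar> \<and>
        dist (C ** (A ** unipotent s)) B < inverse (Suc n)" for n
    proof -
      have "0 < inverse (real (Suc n))" by simp
      then obtain D where D: "D \<in> ?E" "dist D B < inverse (Suc n)"
        using B unfolding closure_approachable by blast
      let ?K = "orbit_arc \<Gamma> A {- real n..real n}"
      have "D \<notin> ?K"
        using D(1) T1_point_in_orbit_iff[OF sub assms(2), of D] unfolding orbit_arc_def by blast
      then have "D \<in> ball B (inverse (Suc n)) - ?K"
        using D(2) by (simp add: dist_commute)
      moreover have "open (ball B (inverse (Suc n)) - ?K)"
        by (intro open_Diff open_ball closed_orbit_arc assms(1,2) compact_Icc)
      moreover have "D \<in> closure (orbit_arc \<Gamma> A UNIV)"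
        using T1_point_in_orbit_closure[OF sub assms(2)] D(1) by blast
      ultimately obtain D' where "D' \<in> orbit_arc \<Gamma> A UNIV"
          and D': "D' \<in> ball B (inverse (Suc n)) - ?K"
        using open_Int_closure_eq_empty by blast
      then obtain C s where C: "C \<in> lift \<Gamma>" "D' = C ** (A ** unipotent s)"
        by (auto simp: orbit_arc_def)
      then have "s \<notin> {- real n..real n}"
        using D' unfolding orbit_arc_def by blast
      then have "real n \<le> \<bar>s\<bar>"
        by auto
      then show ?thesis
        using C D' by (auto simp: dist_commute)
    qed
    then obtain C s where C: "\<And>n. C n \<in> lift \<Gamma>" and s: "\<And>n. real n \<le> \<bar>s n\<bar>"
      and CB: "\<And>n. dist (C n ** (A ** unipotent (s n))) B < inverse (Suc n)"
      by metis
    have "(\<lambda>n. dist (C n ** (A ** unipotent (s n))) B) \<longlonglongrightarrow> 0"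
    proof (rule tendsto_sandwich[OF _ _ tendsto_const LIMSEQ_inverse_real_of_nat])
      show "\<forall>\<^sub>F n in sequentially. dist (C n ** (A ** unipotent (s n))) B \<le> inverse (Suc n)"
        by (rule always_eventually) (rule allI, rule less_imp_le, rule CB)
    qed simp
    then have lim: "(\<lambda>n. C n ** (A ** unipotent (s n))) \<longlonglongrightarrow> B"
      by (rule tendsto_dist_iff[THEN iffD2])
    have "(\<lambda>n. C n ** (A ** unipotent (s n)) ** unipotent (- t)) \<longlonglongrightarrow> B ** unipotent (- t)"
      by (rule isCont_tendsto_compose[OF _ lim]) (intro continuous_intros)
    then have "limitin (T1 \<Gamma>) (\<lambda>n. T1_point \<Gamma> (C n ** (A ** unipotent (s n)) ** unipotent (- t)))
        (T1_point \<Gamma> (B ** unipotent (- t))) sequentially"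
      by (intro limitin_T1_point SL2_mult SL2_unipotent assms(2) BSL lift_SL2[OF C])
    moreover have "T1_point \<Gamma> (C n ** (A ** unipotent (s n)) ** unipotent (- t)) =
        horocyclic_flow (s n - t) (T1_point \<Gamma> A)" for n
    proof -
      have "C n ** (A ** unipotent (s n)) ** unipotent (- t) = C n ** (A ** unipotent (s n - t))"
        by (simp add: unipotent_add flip: matrix_mul_assoc)
      moreover have "A ** unipotent (s n - t) \<in> SL2"
        using assms(2) SL2_unipotent by (rule SL2_mult)
      ultimately show ?thesis
        using T1_point_eq_iff[OF sub, of "A ** unipotent (s n - t)" "C n ** (A ** unipotent (s n - t))"]
          C[of n] lift_SL2[OF C[of n]]
        by (auto simp: horocyclic_flow_T1_point sub assms(2) SL2_mult)
    qed
    moreover have "T1_point \<Gamma> (B ** unipotent (- t)) = T1_point \<Gamma> A"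
    proof -
      have "B ** unipotent (- t) = G ** A"
        by (simp add: G(2) unipotent_add unipotent_0 flip: matrix_mul_assoc)
      then show ?thesis
        using T1_point_eq_iff[OF sub assms(2), of "G ** A"] G(1) lift_SL2[OF G(1)] assms(2)
        by (auto simp: SL2_mult)
    qed
    moreover have "filterlim (\<lambda>n. \<bar>s n - t\<bar>) at_top sequentially"
    proof (rule filterlim_at_top_mono)
      show "filterlim (\<lambda>n. - \<bar>t\<bar> + real n) at_top sequentially"
        by (rule filterlim_tendsto_add_at_top[OF tendsto_const filterlim_real_sequentially])
      show "\<forall>\<^sub>F n in sequentially. - \<bar>t\<bar> + real n \<le> \<bar>s n - t\<bar>"
      proof (intro always_eventually allI)
        show "- \<bar>t\<bar> + real n \<le> \<bar>s n - t\<bar>" for n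
          using s[of n] by linarith
      qed
    qed
    ultimately have "recurrent_orbit \<Gamma> (T1_point \<Gamma> A)"
      unfolding recurrent_orbit_def by (intro exI[of _ "\<lambda>n. s n - t"]) simp
    with assms(3) show False ..
  qed
  then have "closed ?E"
    unfolding closure_subset_eq[symmetric] by (rule subsetI)
  moreover have "?F \<subseteq> T1_point \<Gamma> ` SL2"
    unfolding topspace_T1[symmetric] by (rule closure_of_subset_topspace)
  then have "?F - ?O \<subseteq> T1_point \<Gamma> ` SL2"
    by (rule subset_trans[OF Diff_subset])
  ultimately show ?thesis
    unfolding closedin_T1_iff by (rule conjI[rotated])
qed

theorem mainTheorem1:
  fixes \<Gamma> :: "(real^2^2) set set" and u\<^sub>0 :: "(complex \<times> complex) set"
  assumes "fuchsian \<Gamma>"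
    and "\<And>M. M \<in> \<Gamma> \<Longrightarrow> \<not> elliptic M"
    and "\<not> geometrically_finite \<Gamma>"
    and "u\<^sub>0 \<in> nonwandering_set \<Gamma>"
    and "irregular_orbit \<Gamma> u\<^sub>0"
    and "asymptotic_thinness \<Gamma> u\<^sub>0 = \<infinity>"
  shows "recurrent_orbit \<Gamma> u\<^sub>0 \<or>
         \<not> horocyclic_minimal \<Gamma> (T1 \<Gamma> closure_of (horocyclic_orbit u\<^sub>0))"
proof (rule ccontr)
  let ?O = "horocyclic_orbit u\<^sub>0"
  let ?F = "T1 \<Gamma> closure_of ?O"
  assume "\<not> ?thesis"
  then have nonrec: "\<not> recurrent_orbit \<Gamma> u\<^sub>0" and min: "horocyclic_minimal \<Gamma> ?F"
    by auto
  have sub: "subgroup \<Gamma> PSL2R"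
    using assms(1) by (simp add: fuchsian_def)
  have "u\<^sub>0 \<in> topspace (T1 \<Gamma>)"
    using assms(4) by (simp add: nonwandering_set_def)
  then obtain A where A: "A \<in> SL2" "u\<^sub>0 = T1_point \<Gamma> A"
    unfolding topspace_T1 by blast
  have flow: "horocyclic_flow t (horocyclic_flow s (T1_point \<Gamma> B)) = horocyclic_flow (s + t) (T1_point \<Gamma> B)"
    if "B \<in> SL2" for s t B
    using that sub by (simp add: horocyclic_flow_T1_point SL2_mult SL2_unipotent unipotent_add
        flip: matrix_mul_assoc)
  have flow_0: "horocyclic_flow 0 (T1_point \<Gamma> B) = T1_point \<Gamma> B" if "B \<in> SL2" for B
    using that sub by (simp add: horocyclic_flow_T1_point unipotent_0)
  have "?O \<subseteq> topspace (T1 \<Gamma>)"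
    unfolding topspace_T1 A(2) horocyclic_orbit_def
    using sub A(1) SL2_mult SL2_unipotent by (auto simp: horocyclic_flow_T1_point)
  then have OF: "?O \<subseteq> ?F"
    by (rule closure_of_subset)
  have u0: "u\<^sub>0 \<in> ?O"
    unfolding A(2) horocyclic_orbit_def using flow_0[OF A(1)] by (metis rangeI)
  have "?F - ?O \<noteq> {}"
    using assms(5) OF closedin_closure_of[of "T1 \<Gamma>" ?O]
    by (metis Diff_eq_empty_iff irregular_orbit_def subset_antisym)
  moreover have "?F - ?O \<subset> ?F"
    using u0 OF by blast
  moreover have "closedin (T1 \<Gamma>) (?F - ?O)"
    using closed_orbit_boundary[OF assms(1) A(1)] nonrec by (simp add: A(2))
  moreover have "horocyclic_invariant (?F - ?O)"
    unfolding horocyclic_invariant_def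
  proof (intro allI image_subsetI DiffI notI)
    fix s v assume v: "v \<in> ?F - ?O"
    \<comment> \<open>Invariance of the closure is part of the minimality to be refuted; a point off the orbit
      stays off it, because the flow can be run backwards.\<close>
    then show "horocyclic_flow s v \<in> ?F"
      using min unfolding horocyclic_minimal_def horocyclic_invariant_def by blast
    obtain B where B: "B \<in> SL2" "v = T1_point \<Gamma> B"
      using v closure_of_subset_topspace[of "T1 \<Gamma>" ?O] unfolding topspace_T1 by blast
    assume "horocyclic_flow s v \<in> ?O"
    then obtain t where "horocyclic_flow s v = horocyclic_flow t u\<^sub>0"
      by (auto simp: horocyclic_orbit_def)
    then have "horocyclic_flow (- s) (horocyclic_flow s v) = horocyclic_flow (t - s) u\<^sub>0"
      using flow[OF A(1), of "- s" t] by (simp add: A(2))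
    moreover have "horocyclic_flow (- s) (horocyclic_flow s v) = v"
      using flow[OF B(1), of "- s" s] flow_0[OF B(1)] by (simp add: B(2))
    ultimately have "v \<in> ?O"
      unfolding horocyclic_orbit_def by (metis rangeI)
    with v show False by simp
  qed
  ultimately show False
    using min unfolding horocyclic_minimal_def by blast
qed

end
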